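(* Let $\alpha\in\mathbb Z\setminus\{-1,0\}$ and let $(h_n)$ be the sequence with $h_0=0$, $h_1=1$, $h_2=-\alpha(\alpha+1)$, $h_3=-\alpha^3(\alpha+1)^3$, $h_4=\alpha^6(\alpha+1)^5$, and for $m\ge2$: $h_{2m+1}=h_{m+2}h_m^3-h_{m-1}h_{m+1}^3$, for $m\ge 3$: $h_{2m}=h_m\big(h_{m+2}h_{m-1}^2-h_{m-2}h_{m+1}^2\big)/h_2$. (i) If $n\equiv 2,3,9,10\pmod{12}$, then $h_n$ is not a square. (ii) If $n\equiv 2,5,7,11,13,16\pmod{18}$, then $h_n$ is not a cube.
   Context: The sequence defined is the elliptic divisibility sequence attached to the point $(0,0)$ of order $6$ on the Tate normal form curve with $b=\alpha+\alpha^2$, $c=\alpha$. Convention: an integer $m$ is called a square if $m=\pm\beta^2$ for some nonzero integer $\beta$, and a cube if $m=\beta^3$ for some nonzero integer $\beta$. *)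

theory Defs
  imports Complex_Main
begin

text \<open>
  Squares are taken up to sign, and zero counts neither as a square nor as a cube.
\<close>

definition signed_square :: "int \<Rightarrow> bool" where
  "signed_square m \<longleftrightarrow> (\<exists>\<beta>::int. \<beta> \<noteq> 0 \<and> (m = \<beta>^2 \<or> m = - (\<beta>^2)))"

definition nonzero_cube :: "int \<Rightarrow> bool" where
  "nonzero_cube m \<longleftrightarrow> (\<exists>\<beta>::int. \<beta> \<noteq> 0 \<and> m = \<beta>^3)"

end

theory Submission
  imports Defs "HOL-Computational_Algebra.Nth_Powers"
begin

text \<open>
  Put \<open>t = -\<alpha>\<close>. Up to sign, \<open>h\<^sub>n = t\<^bsup>\<lfloor>5n\<^sup>2/12\<rfloor>\<^esup> (1 - t)\<^bsup>\<lfloor>n\<^sup>2/3\<rfloor>\<^esup>\<close> unless \<open>6\<close> divides \<open>n\<close>, in which case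
  \<open>h\<^sub>n = 0\<close>. The closed form is quasi-periodic, \<open>h\<^bsub>n+6\<^esub> = -(t\<^sup>5 (1 - t)\<^sup>4)\<^bsup>n+3\<^esup> h\<^sub>n\<close>, and the recurrences
  scale consistently under such a shift, so they only have to be checked over one period.
  Modulo \<open>d\<close>, the two exponents depend only on \<open>n\<close> modulo \<open>6d\<close>. For the residues in question they are
  coprime to \<open>d\<close>, so if \<open>h\<^sub>n\<close> were a \<open>d\<close>-th power up to sign, both \<open>|t|\<close> and \<open>|1 - t|\<close> would be \<open>d\<close>-th
  powers; but these are consecutive positive integers.
\<close>

section \<open>Powers of consecutive integers\<close>

lemma is_nth_power_power_coprime_nat_iff:
  fixes x :: nat
  assumes "n > 0" "coprime n k"
  shows "is_nth_power n (x ^ k) \<longleftrightarrow> is_nth_power n x"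
proof (cases "x = 0")
  case True
  then show ?thesis using assms by (cases k) auto
next
  case False
  have "n dvd multiplicity p (x ^ k) \<longleftrightarrow> n dvd multiplicity p x" if "prime p" for p
    using that False assms
    by (simp add: prime_elem_multiplicity_power_distrib coprime_dvd_mult_right_iff)
  then show ?thesis
    using assms by (simp add: is_nth_power_conv_multiplicity_nat)
qed

lemma not_is_nth_power_Suc:
  fixes x :: nat
  assumes "n \<ge> 2" "x > 0" "is_nth_power n x"
  shows "\<not> is_nth_power n (Suc x)"
proof
  assume "is_nth_power n (Suc x)"
  then obtain u v where u: "x = u ^ n" and v: "Suc x = v ^ n"
    using assms(3) by (auto elim!: is_nth_powerE)
  then have "u < v"
    by (metis lessI power_less_imp_less_base zero_le)
  obtain k where k: "n = Suc k" "k > 0"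
    using \<open>n \<ge> 2\<close> by (cases n) auto
  have "u * u ^ k + v ^ k \<le> u * v ^ k + v ^ k"
    using \<open>u < v\<close> by (simp add: power_mono)
  also have "\<dots> \<le> v * v ^ k"
    using mult_le_mono1[of "Suc u" v "v ^ k"] \<open>u < v\<close> by simp
  also have "\<dots> = u * u ^ k + 1"
    using u v k by simp
  finally have "v ^ k \<le> 1"
    by simp
  moreover have "v > 1"
    using u v \<open>u < v\<close> assms by (cases "u = 0") auto
  ultimately show False
    using \<open>k > 0\<close> one_less_power[of v k] by simp
qed

lemma not_is_nth_power_mult_consecutive_int:
  fixes t :: int
  assumes "d \<ge> 2" "t \<notin> {0, 1}" "coprime d i" "coprime d j"
  shows "\<not> is_nth_power d (nat \<bar>t\<bar> ^ i * nat \<bar>1 - t\<bar> ^ j)"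
proof
  assume "is_nth_power d (nat \<bar>t\<bar> ^ i * nat \<bar>1 - t\<bar> ^ j)"
  moreover have consecutive: "nat \<bar>1 - t\<bar> = Suc (nat \<bar>t\<bar>) \<or> nat \<bar>t\<bar> = Suc (nat \<bar>1 - t\<bar>)"
    by (cases "t \<le> 0") (simp_all add: Suc_nat_eq_nat_zadd1)
  then have "coprime (nat \<bar>t\<bar>) (nat \<bar>1 - t\<bar>)"
    by (metis coprime_Suc_left_nat coprime_Suc_right_nat)
  ultimately have "is_nth_power d (nat \<bar>t\<bar> ^ i)" "is_nth_power d (nat \<bar>1 - t\<bar> ^ j)"
    using is_nth_power_mult_coprime_nat_iff by simp_all
  then have "is_nth_power d (nat \<bar>t\<bar>)" "is_nth_power d (nat \<bar>1 - t\<bar>)"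
    using assms by (simp_all add: is_nth_power_power_coprime_nat_iff)
  moreover have "nat \<bar>t\<bar> > 0" "nat \<bar>1 - t\<bar> > 0"
    using assms(2) by auto
  ultimately show False
    using consecutive not_is_nth_power_Suc[OF \<open>d \<ge> 2\<close>] by metis
qed

section \<open>Elliptic recurrences\<close>

text \<open>
  The duplication formulas for \<open>h\<^bsub>2m+1\<^esub>\<close> at \<open>m = k + 1\<close> and for \<open>h\<^bsub>2m\<^esub>\<close> at \<open>m = k + 2\<close>, shifted so that
  no index is a truncated difference.
\<close>

definition elliptic_recurrence :: "(nat \<Rightarrow> 'a::idom) \<Rightarrow> nat \<Rightarrow> bool" where
  "elliptic_recurrence h k \<longleftrightarrow>
     h (2 * k + 3) = h (k + 3) * h (k + 1) ^ 3 - h k * h (k + 2) ^ 3 \<and>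
     h (2 * k + 4) * h 2 = h (k + 2) * (h (k + 4) * h (k + 1) ^ 2 - h k * h (k + 3) ^ 2)"

lemma elliptic_recurrenceI:
  fixes h :: "nat \<Rightarrow> int"
  assumes "h 2 \<noteq> 0" "k \<ge> 1"
    and odd: "\<And>m. m \<ge> 2 \<Longrightarrow> h (2 * m + 1) = h (m + 2) * h m ^ 3 - h (m - 1) * h (m + 1) ^ 3"
    and even: "\<And>m. m \<ge> 3 \<Longrightarrow> (of_int (h (2 * m)) :: rat) =
      of_int (h m * (h (m + 2) * h (m - 1) ^ 2 - h (m - 2) * h (m + 1) ^ 2)) / of_int (h 2)"
  shows "elliptic_recurrence h k"
proof -
  have "(of_int (h (2 * k + 4) * h 2) :: rat) =
      of_int (h (k + 2) * (h (k + 4) * h (k + 1) ^ 2 - h k * h (k + 3) ^ 2))"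
    using even[of "k + 2"] assms(1,2) by (simp add: eval_nat_numeral)
  then show ?thesis
    using odd[of "k + 1"] \<open>k \<ge> 1\<close>
    unfolding elliptic_recurrence_def of_int_eq_iff by (simp add: eval_nat_numeral)
qed

lemma elliptic_recurrence_unique:
  fixes f g :: "nat \<Rightarrow> 'a::idom"
  assumes "\<And>k. k \<ge> 1 \<Longrightarrow> elliptic_recurrence f k" "\<And>k. k \<ge> 1 \<Longrightarrow> elliptic_recurrence g k"
    and "\<And>n. n < 5 \<Longrightarrow> f n = g n" and "f 2 \<noteq> 0"
  shows "f n = g n"
proof (induction n rule: less_induct)
  case (less n)
  have "\<exists>k\<ge>1. n = 2 * k + 3 \<or> n = 2 * k + 4" if "n \<ge> 5"
    using that by presburger
  then consider (initial) "n < 5" | (odd) k where "k \<ge> 1" "n = 2 * k + 3"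
    | (even) k where "k \<ge> 1" "n = 2 * k + 4"
    by (metis not_le)
  then show ?case
  proof cases
    case initial
    then show ?thesis by (rule assms(3))
  next
    case odd
    then show ?thesis
      using assms(1,2)[of k] by (simp add: elliptic_recurrence_def less.IH)
  next
    case even
    then have "f n * f 2 = g n * f 2"
      using assms(1,2)[of k] by (simp add: elliptic_recurrence_def less.IH)
    then show ?thesis
      using \<open>f 2 \<noteq> 0\<close> by simp
  qed
qed

lemma quasi_periodic_double:
  fixes h :: "nat \<Rightarrow> 'a::comm_monoid_mult"
  assumes shift: "\<And>n. h (n + N) = s * A ^ n * h n" and "s ^ 2 = A ^ N"
  shows "h (n + 2 * N) = s ^ 4 * A ^ (2 * n) * h n"
proof -
  have "h (n + 2 * N) = h (n + N + N)"
    by (simp add: mult_2 add.assoc)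
  also have "\<dots> = s ^ 2 * A ^ N * A ^ (2 * n) * h n"
    by (simp only: shift mult_2 power_add power2_eq_square) (simp only: mult_ac)
  also have "s ^ 2 * A ^ N = s ^ 4"
    by (simp flip: \<open>s ^ 2 = A ^ N\<close> power_add)
  finally show ?thesis .
qed

lemma elliptic_recurrence_add_period:
  fixes h :: "nat \<Rightarrow> 'a::idom"
  assumes shift: "\<And>n. h (n + N) = s * A ^ n * h n" and "s ^ 2 = A ^ N"
    and rec: "elliptic_recurrence h k"
  shows "elliptic_recurrence h (k + N)"
proof -
  define y where "y = A ^ k"
  have shift_k: "h (k + N + i) = s * y * A ^ i * h (k + i)" for i
    using shift[of "k + i"] by (simp add: y_def power_add add_ac mult_ac)
  have shift_k_0: "h (k + N) = s * y * h k"
    using shift_k[of 0] by simp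
  have "A ^ (2 * (2 * k + i)) = y ^ 4 * A ^ (2 * i)" for i
    by (simp add: y_def algebra_simps flip: power_mult power_add)
  then have shift_2k: "h (2 * (k + N) + i) = s ^ 4 * y ^ 4 * A ^ (2 * i) * h (2 * k + i)" for i
    using quasi_periodic_double[OF assms(1,2), of "2 * k + i"] by (simp add: algebra_simps)
  have rec_odd: "h (2 * k + 3) = h (k + 3) * h (k + 1) ^ 3 - h k * h (k + 2) ^ 3"
    and rec_even: "h (2 * k + 4) * h 2 =
      h (k + 2) * (h (k + 4) * h (k + 1) ^ 2 - h k * h (k + 3) ^ 2)"
    using rec by (simp_all only: elliptic_recurrence_def)
  have "h (2 * (k + N) + 3) = s ^ 4 * y ^ 4 * A ^ 6 * h (2 * k + 3)"
    using shift_2k[of 3] by simp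
  also have "\<dots> = h (k + N + 3) * h (k + N + 1) ^ 3 - h (k + N) * h (k + N + 2) ^ 3"
    unfolding shift_k shift_k_0 rec_odd by algebra
  finally have odd: "h (2 * (k + N) + 3) =
      h (k + N + 3) * h (k + N + 1) ^ 3 - h (k + N) * h (k + N + 2) ^ 3" .
  have "h (2 * (k + N) + 4) * h 2 = s ^ 4 * y ^ 4 * A ^ 8 * (h (2 * k + 4) * h 2)"
    using shift_2k[of 4] by (simp add: mult_ac)
  also have "\<dots> = h (k + N + 2) * (h (k + N + 4) * h (k + N + 1) ^ 2 - h (k + N) * h (k + N + 3) ^ 2)"
    unfolding shift_k shift_k_0 rec_even by algebra
  finally have even: "h (2 * (k + N) + 4) * h 2 =
      h (k + N + 2) * (h (k + N + 4) * h (k + N + 1) ^ 2 - h (k + N) * h (k + N + 3) ^ 2)" .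
  show ?thesis
    unfolding elliptic_recurrence_def using odd even ..
qed

lemma elliptic_recurrence_if_quasi_periodic:
  fixes h :: "nat \<Rightarrow> 'a::idom"
  assumes "N > 0" "\<And>n. h (n + N) = s * A ^ n * h n" "s ^ 2 = A ^ N"
    and period: "\<And>k. k < N \<Longrightarrow> elliptic_recurrence h k"
  shows "elliptic_recurrence h k"
proof (induction k rule: less_induct)
  case (less k)
  show ?case
  proof (cases "k < N")
    case True
    then show ?thesis by (rule period)
  next
    case False
    then show ?thesis
      using less.IH[of "k - N"] elliptic_recurrence_add_period[OF assms(2,3), of "k - N"] \<open>N > 0\<close>
      by simp
  qed
qed

section \<open>The sequence of the point of order six\<close>

definition order_six_eds :: "'a::idom \<Rightarrow> nat \<Rightarrow> 'a" where
  "order_six_eds t n =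
     (if 6 dvd n then 0
      else (-1) ^ (n div 6) * t ^ (5 * n\<^sup>2 div 12) * (1 - t) ^ (n\<^sup>2 div 3))"

lemma order_six_eds_values:
  shows "order_six_eds t 0 = 0"
    and "order_six_eds t 1 = 1"
    and "order_six_eds t 2 = t * (1 - t)"
    and "order_six_eds t 3 = t ^ 3 * (1 - t) ^ 3"
    and "order_six_eds t 4 = t ^ 6 * (1 - t) ^ 5"
    and "order_six_eds t 5 = t ^ 10 * (1 - t) ^ 8"
    and "order_six_eds t 6 = 0"
    and "order_six_eds t 7 = - (t ^ 20 * (1 - t) ^ 16)"
    and "order_six_eds t 8 = - (t ^ 26 * (1 - t) ^ 21)"
    and "order_six_eds t 9 = - (t ^ 33 * (1 - t) ^ 27)"
    and "order_six_eds t 10 = - (t ^ 41 * (1 - t) ^ 33)"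
    and "order_six_eds t 11 = - (t ^ 50 * (1 - t) ^ 40)"
    and "order_six_eds t 12 = 0"
    and "order_six_eds t 13 = t ^ 70 * (1 - t) ^ 56"
    and "order_six_eds t 14 = t ^ 81 * (1 - t) ^ 65"
  by (simp_all add: order_six_eds_def)

lemma order_six_eds_add_6:
  "order_six_eds t (n + 6) =
     - (t ^ 15 * (1 - t) ^ 12) * (t ^ 5 * (1 - t) ^ 4) ^ n * order_six_eds t n"
proof -
  have "5 * (n + 6)\<^sup>2 = 5 * n\<^sup>2 + (5 * n + 15) * 12" "(n + 6)\<^sup>2 = n\<^sup>2 + (4 * n + 12) * 3"
    by (simp_all add: power2_eq_square algebra_simps)
  then have "5 * (n + 6)\<^sup>2 div 12 = 5 * n\<^sup>2 div 12 + 5 * n + 15"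
    "(n + 6)\<^sup>2 div 3 = n\<^sup>2 div 3 + 4 * n + 12"
    by (simp_all only: div_mult_self1)
  then show ?thesis
    by (simp add: order_six_eds_def power_add power_mult_distrib mult_ac flip: power_mult)
qed

lemma elliptic_recurrence_order_six_eds: "elliptic_recurrence (order_six_eds t) k"
proof (rule elliptic_recurrence_if_quasi_periodic[OF _ order_six_eds_add_6])
  show "(- (t ^ 15 * (1 - t) ^ 12)) ^ 2 = (t ^ 5 * (1 - t) ^ 4) ^ 6"
    by algebra
  have "elliptic_recurrence (order_six_eds t) 0" "elliptic_recurrence (order_six_eds t) 1"
    "elliptic_recurrence (order_six_eds t) 2" "elliptic_recurrence (order_six_eds t) 3"
    "elliptic_recurrence (order_six_eds t) 4" "elliptic_recurrence (order_six_eds t) 5"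
    unfolding elliptic_recurrence_def
    by (rule conjI; simp only: order_six_eds_values arith_simps arith_special
          mult_0_right mult_1_right power_zero_numeral power_one; algebra)+
  moreover have "k \<in> {0, 1, 2, 3, 4, 5}" if "k < 6" for k :: nat
    using that by auto
  ultimately show "elliptic_recurrence (order_six_eds t) k" if "k < 6" for k
    using that by blast
qed simp

lemma order_six_exponents_mod:
  fixes d n :: nat
  shows "5 * n\<^sup>2 div 12 mod d = 5 * (n mod (6 * d))\<^sup>2 div 12 mod d"
    and "n\<^sup>2 div 3 mod d = (n mod (6 * d))\<^sup>2 div 3 mod d"
proof -
  define q r where "q = n div (6 * d)" and "r = n mod (6 * d)"
  have n: "n = 6 * d * q + r"
    by (simp add: q_def r_def)
  have "5 * n\<^sup>2 = 5 * r\<^sup>2 + d * (15 * d * q\<^sup>2 + 5 * q * r) * 12"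
      "n\<^sup>2 = r\<^sup>2 + d * (12 * d * q\<^sup>2 + 4 * q * r) * 3"
    by (simp_all add: n power2_eq_square algebra_simps)
  then show "5 * n\<^sup>2 div 12 mod d = 5 * r\<^sup>2 div 12 mod d" "n\<^sup>2 div 3 mod d = r\<^sup>2 div 3 mod d"
    by (simp_all only: div_mult_self1) simp_all
qed

lemma not_is_nth_power_order_six_eds:
  fixes t :: int
  assumes "t \<notin> {0, 1}" "d \<ge> 2" and r: "r = n mod (6 * d)"
    and "\<not> 6 dvd r" "coprime d (5 * r\<^sup>2 div 12)" "coprime d (r\<^sup>2 div 3)"
  shows "\<not> is_nth_power d (nat \<bar>order_six_eds t n\<bar>)"
proof -
  have "d \<noteq> 0"
    using \<open>d \<ge> 2\<close> by simp
  then have "coprime d (5 * n\<^sup>2 div 12)" "coprime d (n\<^sup>2 div 3)"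
    using assms(5,6) order_six_exponents_mod[of n d] coprime_mod_right_iff[of d]
    unfolding r by metis+
  moreover have "\<not> 6 dvd n"
    using assms by (simp add: dvd_mod_iff)
  then have "nat \<bar>order_six_eds t n\<bar> = nat \<bar>t\<bar> ^ (5 * n\<^sup>2 div 12) * nat \<bar>1 - t\<bar> ^ (n\<^sup>2 div 3)"
    by (simp add: order_six_eds_def abs_mult power_abs nat_mult_distrib nat_power_eq)
  ultimately show ?thesis
    using not_is_nth_power_mult_consecutive_int[OF \<open>d \<ge> 2\<close> \<open>t \<notin> {0, 1}\<close>] by metis
qed

lemma is_nth_power_nat_abs_power:
  fixes x :: int
  shows "is_nth_power d (nat \<bar>x ^ d\<bar>)"
  by (metis abs_ge_zero is_nth_power_nth_power nat_power_eq power_abs)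

lemma not_signed_square_order_six_eds:
  fixes t :: int
  assumes "t \<notin> {0, 1}" "n mod 12 \<in> {2, 3, 9, 10}"
  shows "\<not> signed_square (order_six_eds t n)"
proof
  assume "signed_square (order_six_eds t n)"
  then have "is_nth_power 2 (nat \<bar>order_six_eds t n\<bar>)"
    unfolding signed_square_def by (metis abs_minus_cancel is_nth_power_nat_abs_power)
  moreover have "\<not> 6 dvd r \<and> coprime 2 (5 * r\<^sup>2 div 12) \<and> coprime 2 (r\<^sup>2 div 3)"
    if "r \<in> {2, 3, 9, 10}" for r :: nat
    using that by auto
  ultimately show False
    using assms not_is_nth_power_order_six_eds[of t 2 "n mod 12" n] by simp
qed

lemma not_nonzero_cube_order_six_eds:
  fixes t :: int
  assumes "t \<notin> {0, 1}" "n mod 18 \<in> {2, 5, 7, 11, 13, 16}"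
  shows "\<not> nonzero_cube (order_six_eds t n)"
proof
  assume "nonzero_cube (order_six_eds t n)"
  then have "is_nth_power 3 (nat \<bar>order_six_eds t n\<bar>)"
    unfolding nonzero_cube_def by (metis is_nth_power_nat_abs_power)
  moreover have "\<not> 6 dvd r \<and> coprime 3 (5 * r\<^sup>2 div 12) \<and> coprime 3 (r\<^sup>2 div 3)"
    if "r \<in> {2, 5, 7, 11, 13, 16}" for r :: nat
    using that by (auto simp: coprime_iff_gcd_eq_1 gcd_non_0_nat)
  ultimately show False
    using assms not_is_nth_power_order_six_eds[of t 3 "n mod 18" n] by simp
qed

theorem theorem5p7:
  fixes \<alpha> :: int and h :: "nat \<Rightarrow> int"
  assumes "\<alpha> \<notin> {-1, 0}"
    and "h 0 = 0"
    and "h 1 = 1"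
    and "h 2 = - (\<alpha> * (\<alpha> + 1))"
    and "h 3 = - (\<alpha>^3 * (\<alpha> + 1)^3)"
    and "h 4 = \<alpha>^6 * (\<alpha> + 1)^5"
    and "\<And>m. m \<ge> 2 \<Longrightarrow>
      h (2 * m + 1) = h (m + 2) * h m ^ 3 - h (m - 1) * h (m + 1) ^ 3"
    and "\<And>m. m \<ge> 3 \<Longrightarrow>
      (of_int (h (2 * m)) :: rat) =
        of_int (h m * (h (m + 2) * h (m - 1) ^ 2 - h (m - 2) * h (m + 1) ^ 2)) / of_int (h 2)"
  shows "(\<forall>n. n mod 12 \<in> {2, 3, 9, 10} \<longrightarrow> \<not> signed_square (h n)) \<and>
         (\<forall>n. n mod 18 \<in> {2, 5, 7, 11, 13, 16} \<longrightarrow> \<not> nonzero_cube (h n))"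
proof -
  have "h 2 \<noteq> 0"
    using assms(1,4) by auto
  have rec: "elliptic_recurrence h k" if "k \<ge> 1" for k
    using \<open>h 2 \<noteq> 0\<close> that assms(7,8) by (rule elliptic_recurrenceI)
  have initial: "h n = order_six_eds (- \<alpha>) n" if "n < 5" for n
  proof -
    have "n \<in> {0, 1, 2, 3, 4}"
      using that by auto
    then show ?thesis
      using assms(2-6) by (auto simp: order_six_eds_values add.commute simp del: One_nat_def)
  qed
  have h_eq: "h n = order_six_eds (- \<alpha>) n" for n
    using rec elliptic_recurrence_order_six_eds initial \<open>h 2 \<noteq> 0\<close>
    by (rule elliptic_recurrence_unique)
  show ?thesis
    using assms(1) not_signed_square_order_six_eds[of "- \<alpha>"] not_nonzero_cube_order_six_eds[of "- \<alpha>"]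
    unfolding h_eq by simp
qed

end
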